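(* For every $d\ge1$ and every function $f\colon\{0,1\}^d\to\mathbb{R}$, \[ \mathbb{E}_{\boldsymbol{x}\sim\{0,1\}^d}\Big[\sqrt{I_f(\boldsymbol{x})}\Big]\ \ge\ \frac{\mathtt{dist}(f,\mathbf{const})}{2\sqrt2}, \] where $\boldsymbol{x}$ is uniform on $\{0,1\}^d$.
   Context: Consider the undirected hypercube on $\{0,1\}^d$, whose edges are the pairs $\{x,y\}$ differing in exactly one coordinate. For $x\in\{0,1\}^d$, $I_f(x)$ is the number of edges $\{x,y\}$ with $f(x)>f(y)$. $\mathtt{dist}(f,\mathbf{const})$ is the minimum of $\Pr_{\boldsymbol{x}}[f(\boldsymbol{x})\neq g(\boldsymbol{x})]$ over all constant functions $g\colon\{0,1\}^d\to\mathbb{R}$ ($\boldsymbol{x}$ uniform). *)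

theory Defs
  imports "HOL-Probability.Probability"
begin

text \<open>
  Points of the hypercube are extensional functions on the coordinates \<open>0, \<dots>, d - 1\<close>, so that
  there are exactly \<open>2 ^ d\<close> of them. A real-valued function on the hypercube is a function on the
  whole type; only its values on the hypercube enter the notions below.
\<close>

definition hypercube :: "nat \<Rightarrow> (nat \<Rightarrow> nat) set" where
  "hypercube d = {..<d} \<rightarrow>\<^sub>E {0, 1}"

definition hypercube_edges :: "nat \<Rightarrow> (nat \<Rightarrow> nat) set set" where
  "hypercube_edges d =
     {{x, y} | x y. x \<in> hypercube d \<and> y \<in> hypercube d \<and> card {i \<in> {..<d}. x i \<noteq> y i} = 1}"

definition influence :: "nat \<Rightarrow> ((nat \<Rightarrow> nat) \<Rightarrow> real) \<Rightarrow> (nat \<Rightarrow> nat) \<Rightarrow> nat" where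
  "influence d f x = card {{x, y} | y. {x, y} \<in> hypercube_edges d \<and> f x > f y}"

definition uniform_hypercube :: "nat \<Rightarrow> (nat \<Rightarrow> nat) pmf" where
  "uniform_hypercube d = pmf_of_set (hypercube d)"

definition fun_dist ::
    "nat \<Rightarrow> ((nat \<Rightarrow> nat) \<Rightarrow> real) \<Rightarrow> ((nat \<Rightarrow> nat) \<Rightarrow> real) \<Rightarrow> real" where
  "fun_dist d f g = measure_pmf.prob (uniform_hypercube d) {x. f x \<noteq> g x}"

text \<open>
  The minimum below is genuine: \<open>c\<close> ranges over all reals, but only finitely many distances occur
  (lemma \<open>finite_dist_const\<close>).
\<close>

definition dist_const :: "nat \<Rightarrow> ((nat \<Rightarrow> nat) \<Rightarrow> real) \<Rightarrow> real" where
  "dist_const d f = Min {fun_dist d f (\<lambda>_. c) | c. True}"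

lemma finite_hypercube: "finite (hypercube d)"
  by (simp add: hypercube_def finite_PiE)

lemma hypercube_nonempty: "hypercube d \<noteq> {}"
  by (simp add: hypercube_def PiE_eq_empty_iff)

lemma finite_dist_const: "finite {fun_dist d f (\<lambda>_. c) | c. True}"
proof -
  have "fun_dist d f (\<lambda>_. c) \<in> (\<lambda>A. real (card A) / real (card (hypercube d))) ` Pow (hypercube d)"
    for c
  proof -
    have "fun_dist d f (\<lambda>_. c) =
        real (card (hypercube d \<inter> {x. f x \<noteq> c})) / real (card (hypercube d))"
      by (simp add: fun_dist_def uniform_hypercube_def measure_pmf_of_set finite_hypercube
          hypercube_nonempty)
    then show ?thesis by blast
  qed
  then have "{fun_dist d f (\<lambda>_. c) | c. True} \<subseteq>
      (\<lambda>A. real (card A) / real (card (hypercube d))) ` Pow (hypercube d)"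
    by blast
  then show ?thesis
    by (rule finite_subset) (simp add: finite_hypercube)
qed

end

theory Submission
  imports Defs
begin

text \<open>
  For a set \<open>A\<close> of density \<open>p\<close> in the hypercube, induction on the dimension shows that the mean of
  the square root of the number of edges leaving \<open>A\<close> is at least \<open>\<surd>2 p (1 - p)\<close>. Splitting along
  the last coordinate gives two sets of densities \<open>a \<ge> b\<close>; at least an \<open>a - b\<close> fraction of the
  edges between the two halves leaves the denser one, and the triangle inequality in the plane
  lower-bounds the mean of the square root there by \<open>sqrt (U\<^sup>2 + (a - b)\<^sup>2)\<close>, where \<open>U\<close> is the
  mean without these edges.

  For real-valued \<open>f\<close> with median \<open>m\<close>, the edges leaving \<open>{f > m}\<close> or \<open>{f \<ge> m}\<close> all decrease \<open>f\<close>.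
  The set \<open>{f > m}\<close> and the complement of \<open>{f \<ge> m}\<close> have density at most \<open>1/2\<close>, and these two
  densities add up to the distance of \<open>f\<close> from the constant \<open>m\<close>.
\<close>

section \<open>Densities and outgoing edges of sets, and their splitting along the last
  coordinate\<close>

definition out_degree :: "nat \<Rightarrow> ((nat \<Rightarrow> nat) \<Rightarrow> bool) \<Rightarrow> (nat \<Rightarrow> nat) \<Rightarrow> nat" where
  "out_degree d P x = (if P x then card {i. i < d \<and> \<not> P (x(i := 1 - x i))} else 0)"

definition density :: "nat \<Rightarrow> ((nat \<Rightarrow> nat) \<Rightarrow> bool) \<Rightarrow> real" where
  "density d P = real (card {x \<in> hypercube d. P x}) / 2 ^ d"

lemma card_hypercube: "card (hypercube d) = 2 ^ d"
  by (simp add: hypercube_def card_PiE numeral_2_eq_2)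

lemma sum_hypercube_Suc:
  fixes g :: "(nat \<Rightarrow> nat) \<Rightarrow> real"
  shows "sum g (hypercube (Suc d)) = (\<Sum>x\<in>hypercube d. g (x(d := 0)) + g (x(d := 1)))"
proof -
  have inj: "inj_on (\<lambda>x. x(d := c)) (hypercube d)" for c
  proof (rule inj_onI)
    fix x y assume xy: "x \<in> hypercube d" "y \<in> hypercube d" "x(d := c) = y(d := c)"
    \<comment> \<open>Points of \<open>hypercube d\<close> are extensional, so overwriting
      coordinate \<open>d\<close> loses no information.\<close>
    have "x d = undefined" "y d = undefined"
      using xy by (auto simp: hypercube_def PiE_def extensional_def)
    then show "x = y"
      using xy(3) by (metis fun_upd_triv fun_upd_upd)
  qed
  have split: "hypercube (Suc d)
      = (\<lambda>x. x(d := 0)) ` hypercube d \<union> (\<lambda>x. x(d := 1)) ` hypercube d"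
    unfolding hypercube_def lessThan_Suc PiE_insert_eq by (auto simp: image_iff)
  have "(\<lambda>x. x(d := 0)) ` hypercube d \<inter> (\<lambda>x. x(d := 1)) ` hypercube d = {}"
    by (auto simp: fun_eq_iff split: if_splits)
  then have "sum g (hypercube (Suc d))
      = sum g ((\<lambda>x. x(d := 0)) ` hypercube d) + sum g ((\<lambda>x. x(d := 1)) ` hypercube d)"
    unfolding split by (simp add: sum.union_disjoint finite_hypercube)
  then show ?thesis
    by (simp add: sum.reindex[OF inj] sum.distrib)
qed

lemma density_eq_sum: "density d P = (\<Sum>x\<in>hypercube d. of_bool (P x)) / 2 ^ d"
  unfolding density_def by (simp add: finite_hypercube Int_def)

lemma density_nonneg: "0 \<le> density d P"
  by (simp add: density_def)

lemma density_le_1: "density d P \<le> 1"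
proof -
  have "card {x \<in> hypercube d. P x} \<le> 2 ^ d"
    unfolding card_hypercube[symmetric] by (rule card_mono) (auto simp: finite_hypercube)
  then have "real (card {x \<in> hypercube d. P x}) \<le> real (2 ^ d)"
    by (rule of_nat_mono)
  then show ?thesis by (simp add: density_def)
qed

lemma density_mono:
  assumes "\<And>x. x \<in> hypercube d \<Longrightarrow> P x \<Longrightarrow> Q x"
  shows "density d P \<le> density d Q"
  unfolding density_def using assms
  by (intro divide_right_mono of_nat_mono card_mono) (auto simp: finite_hypercube)

lemma density_not: "density d (\<lambda>x. \<not> P x) = 1 - density d P"
proof -
  have "(\<Sum>x\<in>hypercube d. of_bool (\<not> P x)) = (\<Sum>x\<in>hypercube d. 1 - of_bool (P x) :: real)"
    by (rule sum.cong) auto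
  then show ?thesis
    by (simp add: density_eq_sum sum_subtractf card_hypercube diff_divide_distrib
        del: sum_of_bool_eq)
qed

lemma density_disj:
  assumes "\<And>x. x \<in> hypercube d \<Longrightarrow> \<not> (P x \<and> Q x)"
  shows "density d (\<lambda>x. P x \<or> Q x) = density d P + density d Q"
proof -
  have "(\<Sum>x\<in>hypercube d. of_bool (P x \<or> Q x))
      = (\<Sum>x\<in>hypercube d. of_bool (P x) + of_bool (Q x) :: real)"
    using assms by (intro sum.cong) auto
  then show ?thesis
    by (simp add: density_eq_sum sum.distrib add_divide_distrib del: sum_of_bool_eq)
qed

lemma density_diff_le: "density d P - density d Q \<le> density d (\<lambda>x. P x \<and> \<not> Q x)"
proof -
  have "density d P \<le> density d (\<lambda>x. (P x \<and> \<not> Q x) \<or> Q x)"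
    by (rule density_mono) auto
  also have "\<dots> = density d (\<lambda>x. P x \<and> \<not> Q x) + density d Q"
    by (rule density_disj) auto
  finally show ?thesis by simp
qed

lemma density_Suc:
  "density (Suc d) P = (density d (\<lambda>x. P (x(d := 0))) + density d (\<lambda>x. P (x(d := 1)))) / 2"
  unfolding density_eq_sum sum_hypercube_Suc
  by (simp add: sum.distrib add_divide_distrib mult.commute del: sum_of_bool_eq)

text \<open>Flips below \<open>d\<close> commute with fixing coordinate \<open>d\<close>, so they
  stay in the same half; the only new direction, \<open>d\<close>, leads to the other half.\<close>

lemma out_degree_Suc:
  assumes "c \<in> {0, 1}"
  shows "out_degree (Suc d) P (x(d := c)) = out_degree d (\<lambda>y. P (y(d := c))) x
           + of_bool (P (x(d := c)) \<and> \<not> P (x(d := 1 - c)))"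
proof -
  let ?S = "{i. i < d \<and> \<not> P ((x(i := 1 - x i))(d := c))}"
  have "{i. i < Suc d \<and> \<not> P ((x(d := c))(i := 1 - (x(d := c)) i))}
      = (if P (x(d := 1 - c)) then ?S else insert d ?S)"
    by (auto simp: less_Suc_eq fun_upd_twist)
  then show ?thesis
    by (simp add: out_degree_def)
qed

section \<open>The isoperimetric inequality for sets, by induction on the dimension\<close>

lemma sum_sqrt_add_ge:
  fixes u v :: "'a \<Rightarrow> real"
  assumes "\<And>x. x \<in> X \<Longrightarrow> 0 \<le> u x" "\<And>x. x \<in> X \<Longrightarrow> 0 \<le> v x"
  shows "sqrt ((\<Sum>x\<in>X. sqrt (u x))\<^sup>2 + (\<Sum>x\<in>X. sqrt (v x))\<^sup>2) \<le> (\<Sum>x\<in>X. sqrt (u x + v x))"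
proof -
  \<comment> \<open>Complex numbers model the plane vectors with coordinates
    \<open>sqrt (u x)\<close> and \<open>sqrt (v x)\<close>, whose length is
    \<open>sqrt (u x + v x)\<close>.\<close>
  have "cmod (\<Sum>x\<in>X. Complex (sqrt (u x)) (sqrt (v x)))
      \<le> (\<Sum>x\<in>X. cmod (Complex (sqrt (u x)) (sqrt (v x))))"
    by (rule norm_sum)
  also have "\<dots> = (\<Sum>x\<in>X. sqrt (u x + v x))"
    using assms by (intro sum.cong) (auto simp: complex_norm)
  finally show ?thesis
    by (simp add: cmod_def Re_sum Im_sum)
qed

text \<open>The numerical core of the induction: \<open>U\<close> and \<open>V\<close> are the means
  in the halves of densities \<open>a\<close> and \<open>b\<close>, and \<open>q\<close> is the
  fraction of cross edges leaving the denser half. With J(p) = sqrt 2 * p(1 - p), twice J at the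
  midpoint is J(a) + J(b) + (sqrt 2 / 2)(a - b)^2, so the square root must exceed J(a) by the last
  term.\<close>

lemma two_point_inequality:
  fixes a b q U V :: real
  assumes "0 \<le> b" "b \<le> a" "a \<le> 1" "a - b \<le> q"
    and U: "sqrt 2 * (a * (1 - a)) \<le> U" and V: "sqrt 2 * (b * (1 - b)) \<le> V"
  shows "2 * (sqrt 2 * ((a + b) / 2 * (1 - (a + b) / 2))) \<le> sqrt (U\<^sup>2 + q\<^sup>2) + V"
proof -
  let ?J = "sqrt 2 * (a * (1 - a))" and ?t = "(a - b)\<^sup>2"
  have J0: "0 \<le> ?J" using assms by simp
  \<comment> \<open>After squaring, it suffices that \<open>2 * (a * (1 - a)) + ?t / 2\<close> is at
    most 1; each summand is at most 1/2. The factor sqrt 2 is the largest that these two bounds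
    allow.\<close>
  have "(a - b)\<^sup>2 \<le> 1\<^sup>2" using assms by (intro power_mono) auto
  moreover have "0 \<le> (a - 1/2)\<^sup>2" by simp
  then have "a * (1 - a) \<le> 1/4" by (simp add: power2_eq_square algebra_simps)
  ultimately have "2 * (a * (1 - a)) + ?t / 2 \<le> 1" by simp
  then have "?t * (2 * (a * (1 - a)) + ?t / 2) \<le> ?t * 1"
    by (intro mult_left_mono) auto
  moreover have "(?J + sqrt 2 / 2 * ?t)\<^sup>2 = ?J\<^sup>2 + ?t * (2 * (a * (1 - a)) + ?t / 2)"
    by (simp add: power2_sum power_mult_distrib power_divide)
       (simp add: power2_eq_square algebra_simps power4_eq_xxxx)
  moreover have "?J\<^sup>2 \<le> U\<^sup>2" using J0 U by (rule power_mono[rotated])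
  moreover have "?t \<le> q\<^sup>2" using assms by (intro power_mono) auto
  ultimately have "(?J + sqrt 2 / 2 * ?t)\<^sup>2 \<le> U\<^sup>2 + q\<^sup>2" by linarith
  then have "?J + sqrt 2 / 2 * ?t \<le> sqrt (U\<^sup>2 + q\<^sup>2)" by (rule real_le_rsqrt)
  moreover have "2 * (sqrt 2 * ((a + b) / 2 * (1 - (a + b) / 2)))
      = ?J + sqrt 2 / 2 * ?t + sqrt 2 * (b * (1 - b))"
    by (simp add: power2_eq_square field_simps)
  ultimately show ?thesis using V by linarith
qed

definition mean_sqrt_out_degree :: "nat \<Rightarrow> ((nat \<Rightarrow> nat) \<Rightarrow> bool) \<Rightarrow> real" where
  "mean_sqrt_out_degree d P = (\<Sum>x\<in>hypercube d. sqrt (real (out_degree d P x))) / 2 ^ d"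

lemma mean_sqrt_add_of_bool_ge:
  "sqrt ((mean_sqrt_out_degree d P)\<^sup>2 + (density d Q)\<^sup>2)
     \<le> (\<Sum>x\<in>hypercube d. sqrt (real (out_degree d P x + of_bool (Q x)))) / 2 ^ d"
proof -
  let ?A = "\<Sum>x\<in>hypercube d. sqrt (real (out_degree d P x))"
  let ?B = "\<Sum>x\<in>hypercube d. sqrt (of_bool (Q x))"
  \<comment> \<open>An indicator equals its own square root, so a density is also a mean of square
    roots.\<close>
  have B: "density d Q = ?B / 2 ^ d"
    unfolding density_eq_sum by (intro arg_cong2[where f="(/)"] sum.cong) auto
  have "sqrt ((mean_sqrt_out_degree d P)\<^sup>2 + (density d Q)\<^sup>2) = sqrt (?A\<^sup>2 + ?B\<^sup>2) / 2 ^ d"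
    unfolding mean_sqrt_out_degree_def B
    by (simp add: power_divide add_divide_distrib[symmetric] real_sqrt_divide)
  also have "\<dots> \<le> (\<Sum>x\<in>hypercube d. sqrt (real (out_degree d P x) + of_bool (Q x))) / 2 ^ d"
    by (intro divide_right_mono sum_sqrt_add_ge) auto
  finally show ?thesis by simp
qed

lemma mean_sqrt_out_degree_ge:
  "sqrt 2 * (density d P * (1 - density d P)) \<le> mean_sqrt_out_degree d P"
proof (induction d arbitrary: P)
  case 0
  \<comment> \<open>On a single point the density is 0 or 1, so the left side vanishes.\<close>
  have "hypercube 0 = {\<lambda>_. undefined}" by (simp add: hypercube_def)
  then have "density 0 P = of_bool (P (\<lambda>_. undefined))"
    by (simp add: density_eq_sum del: sum_of_bool_eq)
  then show ?case
    by (simp add: mean_sqrt_out_degree_def sum_nonneg)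
next
  case (Suc d)
  define Q where "Q c = (\<lambda>x. P (x(d := c)))" for c
  define W where "W c = (\<Sum>x\<in>hypercube d. sqrt (real (out_degree (Suc d) P (x(d := c))))) / 2 ^ d"
    for c
  have W: "sqrt ((mean_sqrt_out_degree d (Q c))\<^sup>2 + (density d (\<lambda>x. Q c x \<and> \<not> Q (1 - c) x))\<^sup>2)
      \<le> W c" if "c \<in> {0, 1}" for c
    unfolding W_def out_degree_Suc[OF that]
    using mean_sqrt_add_of_bool_ge[of d "Q c" "\<lambda>x. Q c x \<and> \<not> Q (1 - c) x"]
    by (simp add: Q_def)
  \<comment> \<open>The weaker bound, for the sparser half, discards the edges to the other
    half.\<close>
  have W': "mean_sqrt_out_degree d (Q c) \<le> W c" if "c \<in> {0, 1}" for c
    by (rule order_trans[OF _ W[OF that]]) (simp add: real_le_rsqrt)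
  \<comment> \<open>Here \<open>c\<close> labels the denser half.\<close>
  have step: "2 * (sqrt 2 * ((density d (Q c) + density d (Q (1 - c))) / 2
      * (1 - (density d (Q c) + density d (Q (1 - c))) / 2))) \<le> W c + W (1 - c)"
    if c: "c \<in> {0, 1}" and le: "density d (Q (1 - c)) \<le> density d (Q c)" for c
  proof -
    have c': "1 - c \<in> {0, 1}" using c by auto
    show ?thesis
      using two_point_inequality[OF density_nonneg le density_le_1 density_diff_le
          Suc.IH Suc.IH] W[OF c] W'[OF c'] by (smt (verit))
  qed
  have mean: "mean_sqrt_out_degree (Suc d) P = (W 0 + W 1) / 2"
    unfolding mean_sqrt_out_degree_def sum_hypercube_Suc W_def
    by (simp add: sum.distrib add_divide_distrib mult.commute)
  have dens: "density (Suc d) P = (density d (Q 0) + density d (Q 1)) / 2"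
    unfolding density_Suc Q_def ..
  consider "density d (Q 1) \<le> density d (Q 0)" | "density d (Q 0) \<le> density d (Q 1)"
    by linarith
  then show ?case
  proof cases
    case 1
    then show ?thesis using step[of 0] unfolding mean dens by simp
  next
    case 2
    then show ?thesis using step[of 1] unfolding mean dens by (simp add: add.commute)
  qed
qed

section \<open>Outgoing edges of superlevel sets as decreasing edges of \<open>f\<close>\<close>

lemma flip_in_hypercube:
  assumes "x \<in> hypercube d" "i < d"
  shows "x(i := 1 - x i) \<in> hypercube d"
  using assms unfolding hypercube_def by (auto simp: PiE_iff extensional_def)

lemma flip_neq:
  assumes "x \<in> hypercube d" "i < d"
  shows "1 - x i \<noteq> x i"
proof -
  have "x i \<in> {0, 1}" using assms unfolding hypercube_def by (auto simp: PiE_iff)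
  then show ?thesis by auto
qed

lemma flip_edge:
  assumes x: "x \<in> hypercube d" and i: "i < d"
  shows "{x, x(i := 1 - x i)} \<in> hypercube_edges d"
proof -
  have "{j \<in> {..<d}. x j \<noteq> (x(i := 1 - x i)) j} = {i}"
    using flip_neq[OF x i] i by auto
  then have "card {j \<in> {..<d}. x j \<noteq> (x(i := 1 - x i)) j} = 1" by simp
  then show ?thesis
    unfolding hypercube_edges_def using x flip_in_hypercube[OF x i] by blast
qed

text \<open>Distinct directions give distinct edges at \<open>x\<close>, and each flip that leaves
  \<open>P\<close> lowers \<open>f\<close>.\<close>

lemma out_degree_le_influence:
  assumes x: "x \<in> hypercube d" and P: "\<And>y z. P y \<Longrightarrow> \<not> P z \<Longrightarrow> f z < f y"
  shows "out_degree d P x \<le> influence d f x"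
proof (cases "P x")
  case True
  let ?I = "{i. i < d \<and> \<not> P (x(i := 1 - x i))}"
  let ?E = "{{x, y} | y. {x, y} \<in> hypercube_edges d \<and> f x > f y}"
  have "inj_on (\<lambda>i. {x, x(i := 1 - x i)}) ?I"
  proof (rule inj_onI)
    fix i j assume ij: "i \<in> ?I" "j \<in> ?I" "{x, x(i := 1 - x i)} = {x, x(j := 1 - x j)}"
    then have "x(i := 1 - x i) = x(j := 1 - x j)"
      by (auto simp: doubleton_eq_iff)
    then have "i \<noteq> j \<Longrightarrow> 1 - x i = x i"
      by (metis fun_upd_other fun_upd_same)
    then show "i = j" using flip_neq[OF x] ij(1) by blast
  qed
  moreover have "(\<lambda>i. {x, x(i := 1 - x i)}) ` ?I \<subseteq> ?E"
    using flip_edge[OF x] P[OF True] by blast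
  moreover have "finite ?E"
  proof (rule finite_subset)
    have "hypercube_edges d \<subseteq> Pow (hypercube d)"
      unfolding hypercube_edges_def by auto
    then show "?E \<subseteq> Pow (hypercube d)" by blast
  qed (simp add: finite_hypercube)
  ultimately have "card ?I \<le> card ?E"
    by (rule card_inj_on_le)
  then show ?thesis by (simp add: out_degree_def influence_def True)
qed (simp add: out_degree_def)

lemma expectation_uniform_hypercube:
  fixes g :: "(nat \<Rightarrow> nat) \<Rightarrow> real"
  shows "measure_pmf.expectation (uniform_hypercube d) g = (\<Sum>x\<in>hypercube d. g x) / 2 ^ d"
  unfolding uniform_hypercube_def
  by (simp add: integral_pmf_of_set finite_hypercube hypercube_nonempty card_hypercube)

lemma mean_sqrt_out_degree_le_expectation:
  assumes "\<And>y z. P y \<Longrightarrow> \<not> P z \<Longrightarrow> f z < f y"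
  shows "mean_sqrt_out_degree d P
    \<le> measure_pmf.expectation (uniform_hypercube d) (\<lambda>x. sqrt (real (influence d f x)))"
  unfolding mean_sqrt_out_degree_def expectation_uniform_hypercube
  using out_degree_le_influence[OF _ assms]
  by (intro divide_right_mono sum_mono real_sqrt_le_mono of_nat_mono) auto

section \<open>Medians and the distance to constants\<close>

lemma dist_const_le_density: "dist_const d f \<le> density d (\<lambda>x. f x \<noteq> c)"
proof -
  have "dist_const d f \<le> fun_dist d f (\<lambda>_. c)"
    unfolding dist_const_def by (rule Min_le[OF finite_dist_const]) blast
  also have "\<dots> = density d (\<lambda>x. f x \<noteq> c)"
    by (simp add: fun_dist_def uniform_hypercube_def measure_pmf_of_set finite_hypercube
        hypercube_nonempty density_def card_hypercube Int_def)
  finally show ?thesis .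
qed

lemma exists_median:
  fixes f :: "(nat \<Rightarrow> nat) \<Rightarrow> real"
  obtains m where "density d (\<lambda>x. f x < m) \<le> 1 / 2" "density d (\<lambda>x. m < f x) \<le> 1 / 2"
proof -
  \<comment> \<open>The median is \<open>Min M\<close>, the least attained value whose sublevel set
    has density at least 1/2.\<close>
  define M where "M = {v \<in> f ` hypercube d. 1 / 2 \<le> density d (\<lambda>x. f x \<le> v)}"
  have fin: "finite (f ` hypercube d)" by (simp add: finite_hypercube)
  have finM: "finite M" unfolding M_def using fin by simp
  have "{x \<in> hypercube d. f x \<le> Max (f ` hypercube d)} = hypercube d"
    using fin by auto
  then have "density d (\<lambda>x. f x \<le> Max (f ` hypercube d)) = 1"
    by (simp add: density_def card_hypercube)
  then have "Max (f ` hypercube d) \<in> M"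
    unfolding M_def using Max_in[OF fin] hypercube_nonempty by auto
  then have mM: "Min M \<in> M" using finM by (intro Min_in) auto
  have "density d (\<lambda>x. Min M < f x) = 1 - density d (\<lambda>x. f x \<le> Min M)"
    using density_not[of d "\<lambda>x. f x \<le> Min M"] by (simp add: not_le)
  then have upper: "density d (\<lambda>x. Min M < f x) \<le> 1 / 2"
    using mM by (simp add: M_def)
  have lower: "density d (\<lambda>x. f x < Min M) \<le> 1 / 2"
  proof (cases "\<exists>x\<in>hypercube d. f x < Min M")
    case True
    \<comment> \<open>No value of \<open>f\<close> on the cube lies strictly between
      \<open>Max L\<close> and \<open>Min M\<close>, and minimality of \<open>Min M\<close> keeps
      the sublevel set of \<open>Max L\<close> below density 1/2.\<close>
    define L where "L = {v \<in> f ` hypercube d. v < Min M}"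
    have L: "finite L" "L \<noteq> {}" using fin True by (auto simp: L_def)
    have vL: "Max L \<in> L" using Max_in[OF L] .
    have "Max L \<notin> M" using vL Min_le[OF finM, of "Max L"] by (auto simp: L_def)
    then have "density d (\<lambda>x. f x \<le> Max L) < 1 / 2"
      using vL by (auto simp: L_def M_def)
    moreover have "density d (\<lambda>x. f x < Min M) \<le> density d (\<lambda>x. f x \<le> Max L)"
      using L by (intro density_mono Max_ge) (auto simp: L_def)
    ultimately show ?thesis by simp
  next
    case False
    then have empty: "{x \<in> hypercube d. f x < Min M} = {}" by auto
    show ?thesis unfolding density_def empty by simp
  qed
  from lower upper show thesis by (rule that)
qed

text \<open>Since 1 - p is at least 1/2, the quadratic bound becomes linear in p.\<close>

lemma variance_ge_half:
  fixes p :: real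
  assumes "0 \<le> p" "p \<le> 1 / 2"
  shows "p / sqrt 2 \<le> sqrt 2 * (p * (1 - p))"
proof -
  have "p / sqrt 2 = sqrt 2 * (p * (1 / 2))" by (simp add: field_simps)
  also have "\<dots> \<le> sqrt 2 * (p * (1 - p))"
    using assms by (intro mult_left_mono) auto
  finally show ?thesis .
qed

theorem theorem1p5:
  fixes d :: nat and f :: "(nat \<Rightarrow> nat) \<Rightarrow> real"
  assumes "d \<ge> 1"
  shows "measure_pmf.expectation (uniform_hypercube d) (\<lambda>x. sqrt (real (influence d f x)))
           \<ge> dist_const d f / (2 * sqrt 2)"
proof -
  let ?E = "measure_pmf.expectation (uniform_hypercube d) (\<lambda>x. sqrt (real (influence d f x)))"
  obtain m where lower: "density d (\<lambda>x. f x < m) \<le> 1 / 2"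
    and upper: "density d (\<lambda>x. m < f x) \<le> 1 / 2"
    by (rule exists_median)
  let ?l = "density d (\<lambda>x. f x < m)" and ?u = "density d (\<lambda>x. m < f x)"
  have u: "?u / sqrt 2 \<le> ?E"
    using variance_ge_half[OF density_nonneg upper]
      mean_sqrt_out_degree_ge[of d "\<lambda>x. m < f x"]
      mean_sqrt_out_degree_le_expectation[of "\<lambda>x. m < f x" f d] by linarith
  \<comment> \<open>The bound p(1 - p) is symmetric under complements, so the lower tail is
    controlled by the superlevel set complementary to it.\<close>
  have "density d (\<lambda>x. m \<le> f x) = 1 - ?l"
    using density_not[of d "\<lambda>x. f x < m"] by (simp add: not_less)
  then have "sqrt 2 * (?l * (1 - ?l)) \<le> mean_sqrt_out_degree d (\<lambda>x. m \<le> f x)"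
    using mean_sqrt_out_degree_ge[of d "\<lambda>x. m \<le> f x"] by (simp add: mult.commute)
  then have l: "?l / sqrt 2 \<le> ?E"
    using variance_ge_half[OF density_nonneg lower]
      mean_sqrt_out_degree_le_expectation[of "\<lambda>x. m \<le> f x" f d] by linarith
  have "dist_const d f \<le> density d (\<lambda>x. f x < m \<or> m < f x)"
    using dist_const_le_density[of d f m] by (simp add: neq_iff)
  also have "\<dots> = ?l + ?u"
    by (rule density_disj) auto
  finally have "dist_const d f / sqrt 2 \<le> ?l / sqrt 2 + ?u / sqrt 2"
    by (simp add: divide_right_mono flip: add_divide_distrib)
  \<comment> \<open>Both tails are charged to the same expectation, which costs the factor
    2.\<close>
  then have "dist_const d f / sqrt 2 \<le> 2 * ?E" using u l by linarith
  then show ?thesis by (simp add: field_simps)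
qed

end
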